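(* Let $k$ be a field, $G$ a finite group and $\omega:G^3\to k^\times$ a normalized $3$-cocycle. Let $\mathcal{H}_1^\omega(G^* )$ and $\mathcal{H}_1^\omega(G)$ be the twisted Heisenberg doubles (defined in the context), with canonical elements $$W=\sum_{g\in G}(1_G\#\delta_g)\otimes(g\#1_{k(G)})\in\mathcal{H}_1^\omega(G^* )^{\otimes2},\qquad \bar W=\sum_{g\in G}(\delta_g\#1_G)\otimes(1_{k(G)}\#g)\in\mathcal{H}_1^\omega(G)^{\otimes2}.$$ If $W$ is invertible, then $\omega(a,a^{-1},a)=1$ for every $a\in G$. Likewise, if $\bar W$ is invertible, then $\omega(a,a^{-1},a)=1$ for every $a\in G$. In particular, for $k=\mathbb{C}$, $G=\mathbb{Z}/n\mathbb{Z}$ with $n\ge2$, and the $3$-cocycle $\omega(\overline a,\overline b,\overline c)=\exp\left(\frac{2\pi\sqrt{-1}}{n}abc\right)$, neither $W$ nor $\bar W$ is invertible.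
   Context: A normalized $3$-cocycle satisfies $\omega(a,b,c)\,\omega(a,bc,d)\,\omega(b,c,d)=\omega(ab,c,d)\,\omega(a,b,cd)$ for all $a,b,c,d\in G$, and $\omega(a,b,c)=1$ if at least one of $a,b,c$ is the identity. $k[G]$ is the group algebra, $k(G)$ the algebra of $k$-valued functions on $G$, with delta functions $\delta_a$ and unit $1_{k(G)}=\sum_{a\in G}\delta_a$. $k^\omega(G)$ is $k(G)$ viewed as a quasi-Hopf algebra with pointwise product, $\Delta(\delta_a)=\sum_{gh=a}\delta_g\otimes\delta_h$, $\varepsilon(\delta_a)=\delta_{a,1_G}$, $\Phi=\sum\omega(a,b,c)^{-1}\delta_a\otimes\delta_b\otimes\delta_c$, $S(\delta_a)=\delta_{a^{-1}}$, $\alpha=1_{k(G)}$, $\beta=\sum_a\omega(a,a^{-1},a)\delta_a$. The twisted Heisenberg doubles $\mathcal{H}_1^\omega(G^* )$ and $\mathcal{H}_1^\omega(G)$ are the first Heisenberg doubles of the dual of $k^\omega(G)$ and of $k^\omega(G)$. Explicitly: $\mathcal{H}_1^\omega(G^* )=k[G]\otimes k(G)$ with basis $g\#\delta_a$ ($g,a\in G$), product $(g\#\delta_a)(h\#\delta_b)=\delta_{a,hb}\,\omega(g,h,b)\,gh\#\delta_b$ and unit $1_G\#1_{k(G)}$. $\mathcal{H}_1^\omega(G)=k(G)\otimes k[G]$ with basis $\delta_a\#g$, product $(\delta_a\#g)(\delta_b\#h)=\delta_{b,ag}\,\omega(a,g,h)\,\delta_a\#gh$ and unit $1_{k(G)}\#1_G$.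 These products are in general nonassociative; tensor squares are multiplied componentwise. An element $W$ is invertible if there is an element $V$ of the same tensor square with $WV=VW=$ the unit. *)

theory Defs
  imports Complex_Main "HOL-Algebra.Elementary_Groups"
begin

definition normalized_3_cocycle ::
  "('g, 'm) monoid_scheme \<Rightarrow> ('g \<Rightarrow> 'g \<Rightarrow> 'g \<Rightarrow> 'k::field) \<Rightarrow> bool" where
  "normalized_3_cocycle G \<omega> \<longleftrightarrow>
     (\<forall>a\<in>carrier G. \<forall>b\<in>carrier G. \<forall>c\<in>carrier G. \<omega> a b c \<noteq> 0) \<and>
     (\<forall>a\<in>carrier G. \<forall>b\<in>carrier G. \<forall>c\<in>carrier G. \<forall>d\<in>carrier G.
        \<omega> a b c * \<omega> a (b \<otimes>\<^bsub>G\<^esub> c) d * \<omega> b c d =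
        \<omega> (a \<otimes>\<^bsub>G\<^esub> b) c d * \<omega> a b (c \<otimes>\<^bsub>G\<^esub> d)) \<and>
     (\<forall>a\<in>carrier G. \<forall>b\<in>carrier G. \<forall>c\<in>carrier G.
        a = \<one>\<^bsub>G\<^esub> \<or> b = \<one>\<^bsub>G\<^esub> \<or> c = \<one>\<^bsub>G\<^esub> \<longrightarrow> \<omega> a b c = 1)"

text \<open>
  The vector space with finite basis \<open>B\<close> is the space of coefficient functions vanishing
  outside \<open>B\<close>, and the tensor product of the spaces with bases \<open>B\<close> and \<open>C\<close> is the space with
  basis \<open>B \<times> C\<close>. Both \<open>k[G]\<close> and \<open>k(G)\<close> have a basis indexed by \<open>G\<close>, so that \<open>\<delta> g\<close> stands for
  the group element \<open>g\<close> in the former and for the delta function at \<open>g\<close> in the latter. The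
  symbol \<open>#\<close> of the Heisenberg doubles is the tensor product of elements.
\<close>

definition vec_space :: "'b set \<Rightarrow> ('b \<Rightarrow> 'k::field) set" where
  "vec_space B = {x. \<forall>p. p \<notin> B \<longrightarrow> x p = 0}"

definition basis_vec :: "'b \<Rightarrow> 'b \<Rightarrow> 'k::field" ("\<delta>") where
  "\<delta> p = (\<lambda>q. if q = p then 1 else 0)"

definition tensor :: "('b \<Rightarrow> 'k::field) \<Rightarrow> ('c \<Rightarrow> 'k) \<Rightarrow> 'b \<times> 'c \<Rightarrow> 'k" (infixr "\<otimes>\<^sub>k" 72) where
  "x \<otimes>\<^sub>k y = (\<lambda>(p, q). x p * y q)"

text \<open>
  The record type \<^typ>\<open>'a monoid\<close> is used for a carrier with a product and a unit only: the
  products below are in general not associative. The product of \<open>based_algebra B m u\<close> is the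
  bilinear extension of the products \<open>m p q\<close> of basis vectors. The set \<^const>\<open>Units\<close> consists of
  the elements having a two-sided inverse in the carrier.
\<close>

definition based_algebra ::
  "'b set \<Rightarrow> ('b \<Rightarrow> 'b \<Rightarrow> 'b \<Rightarrow> 'k::field) \<Rightarrow> ('b \<Rightarrow> 'k) \<Rightarrow> ('b \<Rightarrow> 'k) monoid" where
  "based_algebra B m u =
     \<lparr>carrier = vec_space B,
      monoid.mult = (\<lambda>x y r. \<Sum>p\<in>B. \<Sum>q\<in>B. x p * y q * m p q r),
      one = u\<rparr>"

definition tensor_square ::
  "'b set \<Rightarrow> ('b \<Rightarrow> 'k::field) monoid \<Rightarrow> ('b \<times> 'b \<Rightarrow> 'k) monoid" where
  "tensor_square B A =
     based_algebra (B \<times> B)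
       (\<lambda>(p, q) (p', q'). (\<delta> p \<otimes>\<^bsub>A\<^esub> \<delta> p') \<otimes>\<^sub>k (\<delta> q \<otimes>\<^bsub>A\<^esub> \<delta> q'))
       (\<one>\<^bsub>A\<^esub> \<otimes>\<^sub>k \<one>\<^bsub>A\<^esub>)"

definition one_fun :: "('g, 'm) monoid_scheme \<Rightarrow> 'g \<Rightarrow> 'k::field" where
  "one_fun G = (\<lambda>x. \<Sum>a\<in>carrier G. \<delta> a x)"

definition Heisenberg_dual ::
  "('g, 'm) monoid_scheme \<Rightarrow> ('g \<Rightarrow> 'g \<Rightarrow> 'g \<Rightarrow> 'k::field) \<Rightarrow> ('g \<times> 'g \<Rightarrow> 'k) monoid" where
  "Heisenberg_dual G \<omega> =
     based_algebra (carrier G \<times> carrier G)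
       (\<lambda>(g, a) (h, b) r.
          if a = h \<otimes>\<^bsub>G\<^esub> b then \<omega> g h b * (\<delta> (g \<otimes>\<^bsub>G\<^esub> h) \<otimes>\<^sub>k \<delta> b) r else 0)
       (\<delta> \<one>\<^bsub>G\<^esub> \<otimes>\<^sub>k one_fun G)"

definition Heisenberg ::
  "('g, 'm) monoid_scheme \<Rightarrow> ('g \<Rightarrow> 'g \<Rightarrow> 'g \<Rightarrow> 'k::field) \<Rightarrow> ('g \<times> 'g \<Rightarrow> 'k) monoid" where
  "Heisenberg G \<omega> =
     based_algebra (carrier G \<times> carrier G)
       (\<lambda>(a, g) (b, h) r.
          if b = a \<otimes>\<^bsub>G\<^esub> g then \<omega> a g h * (\<delta> a \<otimes>\<^sub>k \<delta> (g \<otimes>\<^bsub>G\<^esub> h)) r else 0)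
       (one_fun G \<otimes>\<^sub>k \<delta> \<one>\<^bsub>G\<^esub>)"

abbreviation Heisenberg_dual_sq ::
  "('g, 'm) monoid_scheme \<Rightarrow> ('g \<Rightarrow> 'g \<Rightarrow> 'g \<Rightarrow> 'k::field) \<Rightarrow> (('g \<times> 'g) \<times> ('g \<times> 'g) \<Rightarrow> 'k) monoid" where
  "Heisenberg_dual_sq G \<omega> \<equiv> tensor_square (carrier G \<times> carrier G) (Heisenberg_dual G \<omega>)"

abbreviation Heisenberg_sq ::
  "('g, 'm) monoid_scheme \<Rightarrow> ('g \<Rightarrow> 'g \<Rightarrow> 'g \<Rightarrow> 'k::field) \<Rightarrow> (('g \<times> 'g) \<times> ('g \<times> 'g) \<Rightarrow> 'k) monoid" where
  "Heisenberg_sq G \<omega> \<equiv> tensor_square (carrier G \<times> carrier G) (Heisenberg G \<omega>)"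

definition canonical_dual :: "('g, 'm) monoid_scheme \<Rightarrow> ('g \<times> 'g) \<times> ('g \<times> 'g) \<Rightarrow> 'k::field" where
  "canonical_dual G =
     (\<lambda>r. \<Sum>g\<in>carrier G. ((\<delta> \<one>\<^bsub>G\<^esub> \<otimes>\<^sub>k \<delta> g) \<otimes>\<^sub>k (\<delta> g \<otimes>\<^sub>k one_fun G)) r)"

definition canonical :: "('g, 'm) monoid_scheme \<Rightarrow> ('g \<times> 'g) \<times> ('g \<times> 'g) \<Rightarrow> 'k::field" where
  "canonical G =
     (\<lambda>r. \<Sum>g\<in>carrier G. ((\<delta> g \<otimes>\<^sub>k \<delta> \<one>\<^bsub>G\<^esub>) \<otimes>\<^sub>k (one_fun G \<otimes>\<^sub>k \<delta> g)) r)"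

definition cyclic_cocycle :: "nat \<Rightarrow> int \<Rightarrow> int \<Rightarrow> int \<Rightarrow> complex" where
  "cyclic_cocycle n a b c = exp (2 * of_real pi * \<i> / of_nat n * of_int (a * b * c))"

text \<open>The value depends only on the residue classes of the arguments.\<close>

lemma cyclic_cocycle_mod:
  assumes "n > 0"
  shows "cyclic_cocycle n (a mod int n) (b mod int n) (c mod int n) = cyclic_cocycle n a b c"
proof -
  have "((a mod int n) * (b mod int n) * (c mod int n)) mod int n = (a * b * c) mod int n"
    by (intro mod_mult_cong) simp_all
  then obtain k where k: "a * b * c = (a mod int n) * (b mod int n) * (c mod int n) + int n * k"
    by (metis mod_eqE)
  have "2 * of_real pi * \<i> / of_nat n * (of_int (a * b * c) :: complex) =
      2 * of_real pi * \<i> / of_nat n * of_int ((a mod int n) * (b mod int n) * (c mod int n))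
      + 2 * of_real pi * \<i> * of_int k"
    unfolding k using assms by (simp add: field_simps)
  moreover have "exp (2 * of_real pi * \<i> * of_int k :: complex) = 1"
    by (simp add: exp_eq_polar cis_multiple_2pi flip: cis_conv_exp)
  ultimately show ?thesis
    by (simp only: cyclic_cocycle_def exp_add mult_1_right)
qed

lemma tensor_basis_vec: "\<delta> p \<otimes>\<^sub>k \<delta> q = \<delta> (p, q)"
  by (auto simp: tensor_def basis_vec_def)

lemma mult_basis_vec:
  assumes "finite B" "p \<in> B" "q \<in> B"
  shows "\<delta> p \<otimes>\<^bsub>based_algebra B m u\<^esub> \<delta> q = m p q"
proof
  fix r
  have "(\<delta> p \<otimes>\<^bsub>based_algebra B m u\<^esub> \<delta> q) r =
      (\<Sum>p'\<in>B. \<Sum>q'\<in>B. if p' = p then (if q' = q then m p q r else 0) else 0)"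
    by (auto simp: based_algebra_def basis_vec_def intro!: sum.cong)
  also have "\<dots> = (\<Sum>p'\<in>B. if p' = p then m p q r else 0)"
    using assms by (intro sum.cong) auto
  finally show "(\<delta> p \<otimes>\<^bsub>based_algebra B m u\<^esub> \<delta> q) r = m p q r"
    using assms by simp
qed

lemma tensor_square_mult:
  fixes B :: "'a set"
  assumes "finite B" and A_def: "A = based_algebra B m u"
  shows "(x \<otimes>\<^sub>k y) \<otimes>\<^bsub>tensor_square B A\<^esub> (x' \<otimes>\<^sub>k y') =
    (x \<otimes>\<^bsub>A\<^esub> x') \<otimes>\<^sub>k (y \<otimes>\<^bsub>A\<^esub> y')"
proof
  fix r :: "'a \<times> 'a"
  obtain s t where r: "r = (s, t)" by (cases r)
  have "((x \<otimes>\<^sub>k y) \<otimes>\<^bsub>tensor_square B A\<^esub> (x' \<otimes>\<^sub>k y')) r =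
      (\<Sum>(p, q)\<in>B \<times> B. \<Sum>(p', q')\<in>B \<times> B.
         (x p * x' p' * m p p' s) * (y q * y' q' * m q q' t))"
    unfolding tensor_square_def
    by (subst (1) based_algebra_def)
       (auto simp: A_def mult_basis_vec assms(1) tensor_def r mult_ac intro!: sum.cong)
  also have "\<dots> = (\<Sum>p\<in>B. \<Sum>q\<in>B. \<Sum>p'\<in>B. \<Sum>q'\<in>B.
         (x p * x' p' * m p p' s) * (y q * y' q' * m q q' t))"
    by (simp flip: sum.cartesian_product)
  also have "\<dots> = (\<Sum>p\<in>B. \<Sum>p'\<in>B. x p * x' p' * m p p' s) * (\<Sum>q\<in>B. \<Sum>q'\<in>B. y q * y' q' * m q q' t)"
    by (simp only: sum_product)
  finally show "((x \<otimes>\<^sub>k y) \<otimes>\<^bsub>tensor_square B A\<^esub> (x' \<otimes>\<^sub>k y')) r =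
      ((x \<otimes>\<^bsub>A\<^esub> x') \<otimes>\<^sub>k (y \<otimes>\<^bsub>A\<^esub> y')) r"
    by (simp add: A_def based_algebra_def tensor_def r)
qed

lemma Heisenberg_dual_mult_basis:
  assumes "finite (carrier G)" "g \<in> carrier G" "a \<in> carrier G" "h \<in> carrier G" "b \<in> carrier G"
  shows "(\<delta> g \<otimes>\<^sub>k \<delta> a) \<otimes>\<^bsub>Heisenberg_dual G \<omega>\<^esub> (\<delta> h \<otimes>\<^sub>k \<delta> b) =
    (\<lambda>r. if a = h \<otimes>\<^bsub>G\<^esub> b then \<omega> g h b * (\<delta> (g \<otimes>\<^bsub>G\<^esub> h) \<otimes>\<^sub>k \<delta> b) r else 0)"
  using assms by (simp add: Heisenberg_dual_def mult_basis_vec tensor_basis_vec)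

lemma Heisenberg_mult_basis:
  assumes "finite (carrier G)" "g \<in> carrier G" "a \<in> carrier G" "h \<in> carrier G" "b \<in> carrier G"
  shows "(\<delta> a \<otimes>\<^sub>k \<delta> g) \<otimes>\<^bsub>Heisenberg G \<omega>\<^esub> (\<delta> b \<otimes>\<^sub>k \<delta> h) =
    (\<lambda>r. if b = a \<otimes>\<^bsub>G\<^esub> g then \<omega> a g h * (\<delta> a \<otimes>\<^sub>k \<delta> (g \<otimes>\<^bsub>G\<^esub> h)) r else 0)"
  using assms by (simp add: Heisenberg_def mult_basis_vec tensor_basis_vec)

lemma canonical_in_carrier:
  assumes "group G"
  shows "canonical_dual G \<in> carrier (Heisenberg_dual_sq G \<omega>)"
    and "canonical G \<in> carrier (Heisenberg_sq G \<omega>)"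
proof -
  interpret group G by fact
  show "canonical_dual G \<in> carrier (Heisenberg_dual_sq G \<omega>)"
    and "canonical G \<in> carrier (Heisenberg_sq G \<omega>)"
    by (auto simp: canonical_dual_def canonical_def tensor_square_def based_algebra_def
        vec_space_def tensor_def one_fun_def basis_vec_def intro!: sum.neutral split: if_splits)
qed

end

theory Submission
  imports Defs
begin

text \<open>
  Let \<open>V\<close> be an inverse. Apart from \<open>V\<close>, exactly one pair of basis vectors contributes to each
  coefficient of \<open>W V\<close> and of \<open>V W\<close>. The coefficient \<open>v\<close> of \<open>V\<close> at
  \<open>(1 # \<delta> a) \<otimes> (a\<inverse> # \<delta> a)\<close> occurs once in each: comparing with the unit gives
  \<open>v \<omega>(a, a\<inverse>, a) = 1\<close> from \<open>W V\<close> and \<open>v \<omega>(a\<inverse>, a, 1) = 1\<close>, that is \<open>v = 1\<close>, from \<open>V W\<close>.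
  For the other double, the coefficient at \<open>(\<delta> a # 1) \<otimes> (\<delta> a # a\<inverse>)\<close> plays the same role.
\<close>

section \<open>Coefficients of products in the two doubles\<close>

text \<open>The support hypothesis takes \<open>f p q \<noteq> 0\<close> as a premise, so that the
  conditions for a nonzero structure constant become equations that determine the pair.\<close>

lemma sum_sum_single:
  fixes f :: "'a \<Rightarrow> 'b \<Rightarrow> 'c::comm_monoid_add"
  assumes "finite A" "finite B" "a \<in> A" "b \<in> B"
    and zero: "\<And>p q. p \<in> A \<Longrightarrow> q \<in> B \<Longrightarrow> f p q \<noteq> 0 \<Longrightarrow> p = a \<and> q = b"
  shows "(\<Sum>p\<in>A. \<Sum>q\<in>B. f p q) = f a b"
proof -
  have "(\<Sum>p\<in>A. \<Sum>q\<in>B. f p q) = (\<Sum>r\<in>A \<times> B. f (fst r) (snd r))"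
    by (simp add: sum.cartesian_product case_prod_beta)
  also have "\<dots> = (\<Sum>r\<in>{(a, b)}. f (fst r) (snd r))"
    using assms(1-4) by (intro sum.mono_neutral_right) (auto dest: zero)
  finally show ?thesis by simp
qed

text \<open>The products of basis vectors of \<open>A\<close> stay unevaluated, so one expansion
  serves both doubles.\<close>

lemma tensor_square_mult_coeff:
  "(x \<otimes>\<^bsub>tensor_square B A\<^esub> y) (s, t) =
    (\<Sum>p\<in>B \<times> B. \<Sum>q\<in>B \<times> B. x p * y q *
      ((\<delta> (fst p) \<otimes>\<^bsub>A\<^esub> \<delta> (fst q)) s * (\<delta> (snd p) \<otimes>\<^bsub>A\<^esub> \<delta> (snd q)) t))"
  by (simp add: tensor_square_def based_algebra_def tensor_def case_prod_beta)

lemma one_tensor_square: "\<one>\<^bsub>tensor_square B A\<^esub> = \<one>\<^bsub>A\<^esub> \<otimes>\<^sub>k \<one>\<^bsub>A\<^esub>"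
  by (simp add: tensor_square_def based_algebra_def)

lemma one_Heisenberg_dual: "\<one>\<^bsub>Heisenberg_dual G \<omega>\<^esub> = \<delta> \<one>\<^bsub>G\<^esub> \<otimes>\<^sub>k one_fun G"
  by (simp add: Heisenberg_dual_def based_algebra_def)

lemma one_Heisenberg: "\<one>\<^bsub>Heisenberg G \<omega>\<^esub> = one_fun G \<otimes>\<^sub>k \<delta> \<one>\<^bsub>G\<^esub>"
  by (simp add: Heisenberg_def based_algebra_def)

lemma one_fun_apply:
  "finite (carrier G) \<Longrightarrow> one_fun G x = (if x \<in> carrier G then 1 else 0)"
  by (simp add: one_fun_def basis_vec_def)

lemma canonical_dual_coeff:
  assumes "finite (carrier G)"
  shows "canonical_dual G ((g, a), (h, b)) =
    (if g = \<one>\<^bsub>G\<^esub> \<and> a = h \<and> a \<in> carrier G \<and> b \<in> carrier G then 1 else 0)"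
proof -
  have "canonical_dual G ((g, a), (h, b)) =
    (\<Sum>x\<in>carrier G. if a = x then if g = \<one>\<^bsub>G\<^esub> \<and> a = h \<and> b \<in> carrier G then 1 else 0 else 0)"
    unfolding canonical_dual_def
    by (intro sum.cong) (auto simp: tensor_def basis_vec_def one_fun_apply assms)
  then show ?thesis using assms by auto
qed

lemma canonical_coeff:
  assumes "finite (carrier G)"
  shows "canonical G ((a, g), (b, h)) =
    (if g = \<one>\<^bsub>G\<^esub> \<and> a = h \<and> a \<in> carrier G \<and> b \<in> carrier G then 1 else 0)"
proof -
  have "canonical G ((a, g), (b, h)) =
    (\<Sum>x\<in>carrier G. if a = x then if g = \<one>\<^bsub>G\<^esub> \<and> a = h \<and> b \<in> carrier G then 1 else 0 else 0)"
    unfolding canonical_def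
    by (intro sum.cong) (auto simp: tensor_def basis_vec_def one_fun_apply assms)
  then show ?thesis using assms by auto
qed

text \<open>Uses \<open>fst\<close> and \<open>snd\<close> to match the expansion in
  \<open>tensor_square_mult_coeff\<close>, and gathers all support conditions in one test.\<close>

lemma Heisenberg_dual_mult_coeff:
  assumes "finite (carrier G)" "p \<in> carrier G \<times> carrier G" "q \<in> carrier G \<times> carrier G"
  shows "(\<delta> p \<otimes>\<^bsub>Heisenberg_dual G \<omega>\<^esub> \<delta> q) r =
    (if snd p = fst q \<otimes>\<^bsub>G\<^esub> snd q \<and> r = (fst p \<otimes>\<^bsub>G\<^esub> fst q, snd q)
     then \<omega> (fst p) (fst q) (snd q) else 0)"
  using assms
  by (cases p; cases q; simp add: Heisenberg_dual_def mult_basis_vec tensor_basis_vec)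
    (auto simp: basis_vec_def)

lemma Heisenberg_mult_coeff:
  assumes "finite (carrier G)" "p \<in> carrier G \<times> carrier G" "q \<in> carrier G \<times> carrier G"
  shows "(\<delta> p \<otimes>\<^bsub>Heisenberg G \<omega>\<^esub> \<delta> q) r =
    (if fst q = fst p \<otimes>\<^bsub>G\<^esub> snd p \<and> r = (fst p, snd p \<otimes>\<^bsub>G\<^esub> snd q)
     then \<omega> (fst p) (snd p) (snd q) else 0)"
  using assms
  by (cases p; cases q; simp add: Heisenberg_def mult_basis_vec tensor_basis_vec)
    (auto simp: basis_vec_def)

lemma normalized_3_cocycle_one:
  assumes "normalized_3_cocycle G \<omega>" "a \<in> carrier G" "b \<in> carrier G" "c \<in> carrier G"
    and "a = \<one>\<^bsub>G\<^esub> \<or> b = \<one>\<^bsub>G\<^esub> \<or> c = \<one>\<^bsub>G\<^esub>"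
  shows "\<omega> a b c = 1"
  using assms unfolding normalized_3_cocycle_def by blast

section \<open>Products of the canonical elements with an arbitrary element\<close>

context group
begin

text \<open>In the first leg a left factor \<open>(\<one>, t)\<close> and the product
  \<open>(\<one>, a)\<close> force \<open>t = a\<close> and the right factor
  \<open>(\<one>, a)\<close>; the cocycle value there is 1 by normalization. In the second leg
  \<open>a\<close> times the group index of the right factor must be \<open>\<one>\<close>, so that
  index is \<open>inv a\<close>.\<close>

lemma canonical_dual_mult_coeff:
  assumes fin: "finite (carrier G)" and \<omega>: "normalized_3_cocycle G \<omega>"
    and a: "a \<in> carrier G" and b: "b \<in> carrier G"
  shows "(canonical_dual G \<otimes>\<^bsub>Heisenberg_dual_sq G \<omega>\<^esub> V) ((\<one>, a), (\<one>, b)) =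
    V ((\<one>, a), (inv a, b)) * \<omega> a (inv a) b"
  unfolding tensor_square_mult_coeff
proof (rule trans[OF sum_sum_single
    [where a = "((\<one>, a), (a, inv a \<otimes> b))" and
      b = "((\<one>, a), (inv a, b))"]], goal_cases)
  \<comment> \<open>Case 5 is uniqueness: no other pair contributes. The other cases are finiteness,
    membership and the value of the surviving term.\<close>
  case (5 p q)
  obtain s t u v s' t' u' v' where "p = ((s, t), (u, v))" "q = ((s', t'), (u', v'))"
    by (metis surj_pair)
  with 5 show ?case
    using a b by (simp add: fin Heisenberg_dual_mult_coeff canonical_dual_coeff split: if_split_asm)
      (auto intro!: inv_unique' intro: inv_comm)
qed (use a b in \<open>auto simp: fin Heisenberg_dual_mult_coeff canonical_dual_coeff
  normalized_3_cocycle_one[OF \<omega>]\<close>)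

text \<open>With the canonical element on the right, \<open>a\<close> is the right group factor of
  the second leg, so \<open>inv a\<close> comes first in the cocycle; the delta condition gives
  \<open>V\<close> the label \<open>a \<otimes> b\<close>.\<close>

lemma mult_canonical_dual_coeff:
  assumes fin: "finite (carrier G)" and \<omega>: "normalized_3_cocycle G \<omega>"
    and a: "a \<in> carrier G" and b: "b \<in> carrier G"
  shows "(V \<otimes>\<^bsub>Heisenberg_dual_sq G \<omega>\<^esub> canonical_dual G) ((\<one>, a), (\<one>, b)) =
    V ((\<one>, a), (inv a, a \<otimes> b)) * \<omega> (inv a) a b"
  unfolding tensor_square_mult_coeff
proof (rule trans[OF sum_sum_single
    [where a = "((\<one>, a), (inv a, a \<otimes> b))" and
      b = "((\<one>, a), (a, b))"]], goal_cases)
  case (5 p q)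
  obtain s t u v s' t' u' v' where "p = ((s, t), (u, v))" "q = ((s', t'), (u', v'))"
    by (metis surj_pair)
  with 5 show ?case
    using a b by (simp add: fin Heisenberg_dual_mult_coeff canonical_dual_coeff split: if_split_asm)
      (auto intro!: inv_unique' intro: inv_comm)
qed (use a b in \<open>auto simp: fin Heisenberg_dual_mult_coeff canonical_dual_coeff
  normalized_3_cocycle_one[OF \<omega>]\<close>)

text \<open>In this double a product keeps the delta label of its left factor: \<open>b\<close>
  labels the second leg of the canonical element, and \<open>V\<close> is read at the shifted label
  \<open>b \<otimes> a\<close>.\<close>

lemma canonical_mult_coeff:
  assumes fin: "finite (carrier G)" and \<omega>: "normalized_3_cocycle G \<omega>"
    and a: "a \<in> carrier G" and b: "b \<in> carrier G"
  shows "(canonical G \<otimes>\<^bsub>Heisenberg_sq G \<omega>\<^esub> V) ((a, \<one>), (b, \<one>)) =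
    V ((a, \<one>), (b \<otimes> a, inv a)) * \<omega> b a (inv a)"
  unfolding tensor_square_mult_coeff
proof (rule trans[OF sum_sum_single
    [where a = "((a, \<one>), (b, a))" and
      b = "((a, \<one>), (b \<otimes> a, inv a))"]], goal_cases)
  case (5 p q)
  obtain s t u v s' t' u' v' where "p = ((s, t), (u, v))" "q = ((s', t'), (u', v'))"
    by (metis surj_pair)
  with 5 show ?case
    using a b by (simp add: fin Heisenberg_mult_coeff canonical_coeff split: if_split_asm)
      (auto intro!: inv_unique' intro: inv_comm)
qed (use a b in \<open>auto simp: fin Heisenberg_mult_coeff canonical_coeff
  normalized_3_cocycle_one[OF \<omega>]\<close>)

text \<open>Here \<open>b\<close> labels \<open>V\<close>, and the shift falls on the canonical
  element, whose second leg contains every label through \<open>one_fun\<close>.\<close>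

lemma mult_canonical_coeff:
  assumes fin: "finite (carrier G)" and \<omega>: "normalized_3_cocycle G \<omega>"
    and a: "a \<in> carrier G" and b: "b \<in> carrier G"
  shows "(V \<otimes>\<^bsub>Heisenberg_sq G \<omega>\<^esub> canonical G) ((a, \<one>), (b, \<one>)) =
    V ((a, \<one>), (b, inv a)) * \<omega> b (inv a) a"
  unfolding tensor_square_mult_coeff
proof (rule trans[OF sum_sum_single
    [where a = "((a, \<one>), (b, inv a))" and
      b = "((a, \<one>), (b \<otimes> inv a, a))"]], goal_cases)
  case (5 p q)
  obtain s t u v s' t' u' v' where "p = ((s, t), (u, v))" "q = ((s', t'), (u', v'))"
    by (metis surj_pair)
  with 5 show ?case
    using a b by (simp add: fin Heisenberg_mult_coeff canonical_coeff split: if_split_asm)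
      (auto intro!: inv_unique' intro: inv_comm)
qed (use a b in \<open>auto simp: fin Heisenberg_mult_coeff canonical_coeff
  normalized_3_cocycle_one[OF \<omega>]\<close>)

section \<open>Consequences of invertibility\<close>

lemma canonical_dual_Units_imp:
  assumes fin: "finite (carrier G)" and \<omega>: "normalized_3_cocycle G \<omega>"
    and unit: "canonical_dual G \<in> Units (Heisenberg_dual_sq G \<omega>)" and a: "a \<in> carrier G"
  shows "\<omega> a (inv a) a = 1"
proof -
  from unit obtain V where
    WV: "canonical_dual G \<otimes>\<^bsub>Heisenberg_dual_sq G \<omega>\<^esub> V = \<one>\<^bsub>Heisenberg_dual_sq G \<omega>\<^esub>" and
    VW: "V \<otimes>\<^bsub>Heisenberg_dual_sq G \<omega>\<^esub> canonical_dual G = \<one>\<^bsub>Heisenberg_dual_sq G \<omega>\<^esub>"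
    unfolding Units_def by blast
  have one: "\<one>\<^bsub>Heisenberg_dual_sq G \<omega>\<^esub> ((\<one>, x), (\<one>, y)) = 1"
    if "x \<in> carrier G" "y \<in> carrier G" for x y
    using that
    by (simp add: one_tensor_square one_Heisenberg_dual tensor_def basis_vec_def one_fun_apply fin)
  have "V ((\<one>, a), (inv a, a)) * \<omega> a (inv a) a = 1"
    using canonical_dual_mult_coeff[OF fin \<omega> a a, of V] a by (simp add: WV one)
  \<comment> \<open>The choice \<open>b = \<one>\<close> reaches the same coefficient of
    \<open>V\<close>, since \<open>a \<otimes> \<one> = a\<close>, and makes the cocycle value
    1.\<close>
  moreover have "V ((\<one>, a), (inv a, a)) = 1"
    using mult_canonical_dual_coeff[OF fin \<omega> a one_closed, of V] a
    by (simp add: VW one normalized_3_cocycle_one[OF \<omega>])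
  ultimately show ?thesis by simp
qed

lemma canonical_Units_imp:
  assumes fin: "finite (carrier G)" and \<omega>: "normalized_3_cocycle G \<omega>"
    and unit: "canonical G \<in> Units (Heisenberg_sq G \<omega>)" and a: "a \<in> carrier G"
  shows "\<omega> a (inv a) a = 1"
proof -
  from unit obtain V where
    WV: "canonical G \<otimes>\<^bsub>Heisenberg_sq G \<omega>\<^esub> V = \<one>\<^bsub>Heisenberg_sq G \<omega>\<^esub>" and
    VW: "V \<otimes>\<^bsub>Heisenberg_sq G \<omega>\<^esub> canonical G = \<one>\<^bsub>Heisenberg_sq G \<omega>\<^esub>"
    unfolding Units_def by blast
  have one: "\<one>\<^bsub>Heisenberg_sq G \<omega>\<^esub> ((x, \<one>), (y, \<one>)) = 1"
    if "x \<in> carrier G" "y \<in> carrier G" for x y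
    using that
    by (simp add: one_tensor_square one_Heisenberg tensor_def basis_vec_def one_fun_apply fin)
  \<comment> \<open>The sides exchange roles: \<open>b = \<one>\<close> is now taken in the product
    with \<open>V\<close> on the right, and \<open>b = a\<close> in the other.\<close>
  have "V ((a, \<one>), (a, inv a)) = 1"
    using canonical_mult_coeff[OF fin \<omega> a one_closed, of V] a
    by (simp add: WV one normalized_3_cocycle_one[OF \<omega>])
  moreover have "V ((a, \<one>), (a, inv a)) * \<omega> a (inv a) a = 1"
    using mult_canonical_coeff[OF fin \<omega> a a, of V] a by (simp add: VW one)
  ultimately show ?thesis by simp
qed

end

section \<open>The cyclic example\<close>

text \<open>The exponent \<open>a * b * c\<close> is trilinear, so both sides of the cocycle
  identity have exponent \<open>abc + abd + acd + bcd\<close>.\<close>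

lemma normalized_3_cocycle_cyclic:
  assumes n: "n > 0"
  shows "normalized_3_cocycle (integer_mod_group n) (cyclic_cocycle n)"
proof -
  \<comment> \<open>Reducing all three arguments on both sides gives the same value, since reduction
    is idempotent.\<close>
  have mod1: "cyclic_cocycle n (x mod int n) y z = cyclic_cocycle n x y z"
    and mod2: "cyclic_cocycle n x (y mod int n) z = cyclic_cocycle n x y z"
    and mod3: "cyclic_cocycle n x y (z mod int n) = cyclic_cocycle n x y z" for x y z
    using cyclic_cocycle_mod[OF n, of "x mod int n" y z] cyclic_cocycle_mod[OF n, of x "y mod int n" z]
      cyclic_cocycle_mod[OF n, of x y "z mod int n"] cyclic_cocycle_mod[OF n, of x y z]
    by simp_all
  have "cyclic_cocycle n a b c * cyclic_cocycle n a (b + c) d * cyclic_cocycle n b c d =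
      cyclic_cocycle n (a + b) c d * cyclic_cocycle n a b (c + d)" for a b c d
    by (simp add: cyclic_cocycle_def algebra_simps flip: exp_add)
  moreover have "cyclic_cocycle n a b c = 1" if "a = 0 \<or> b = 0 \<or> c = 0" for a b c
    using that by (auto simp: cyclic_cocycle_def)
  moreover have "cyclic_cocycle n a b c \<noteq> 0" for a b c
    by (simp add: cyclic_cocycle_def)
  ultimately show ?thesis
    by (simp add: normalized_3_cocycle_def mult_integer_mod_group mod1 mod2 mod3)
qed

text \<open>The inverse of the class of 1 is the class of -1, so the value is
  \<open>exp (-2 pi i / n)\<close>, a primitive n-th root of unity.\<close>

lemma cyclic_cocycle_inv_neq_1:
  assumes n: "n \<ge> 2"
  shows "cyclic_cocycle n 1 (inv\<^bsub>integer_mod_group n\<^esub> 1) 1 \<noteq> 1"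
proof
  assume eq: "cyclic_cocycle n 1 (inv\<^bsub>integer_mod_group n\<^esub> 1) 1 = 1"
  have "inv\<^bsub>integer_mod_group n\<^esub> 1 = (- 1) mod int n"
    using n by (subst inv_integer_mod_group) (auto simp: carrier_integer_mod_group)
  then have "cyclic_cocycle n 1 (- 1) 1 = 1"
    using eq cyclic_cocycle_mod[of n 1 "- 1" 1] n by simp
  moreover have "cyclic_cocycle n 1 (- 1) 1 = cis (- (2 * pi / real n))"
    by (simp add: cyclic_cocycle_def cis_conv_exp mult_ac)
  \<comment> \<open>Real parts suffice: cosine 1 would make 1/n an integer.\<close>
  ultimately have "cos (2 * pi / real n) = 1"
    by (metis cis.sel(1) cos_minus one_complex.sel(1))
  then obtain k :: int where "2 * pi / real n = of_int k * 2 * pi"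
    unfolding cos_one_2pi_int by blast
  then have "1 = real_of_int (k * int n)"
    using n by (simp add: field_simps)
  then have "int n dvd 1"
    by (metis dvd_triv_right of_int_eq_1_iff)
  with n show False by simp
qed


theorem mainTheorem3:
  "(\<forall>(G :: ('g, 'm) monoid_scheme) (\<omega> :: 'g \<Rightarrow> 'g \<Rightarrow> 'g \<Rightarrow> 'k::field).
      group G \<and> finite (carrier G) \<and> normalized_3_cocycle G \<omega> \<longrightarrow>
        (canonical_dual G \<in> Units (Heisenberg_dual_sq G \<omega>) \<longrightarrow>
           (\<forall>a\<in>carrier G. \<omega> a (inv\<^bsub>G\<^esub> a) a = 1)) \<and>
        (canonical G \<in> Units (Heisenberg_sq G \<omega>) \<longrightarrow>
           (\<forall>a\<in>carrier G. \<omega> a (inv\<^bsub>G\<^esub> a) a = 1))) \<and>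
   (\<forall>n\<ge>2.
      normalized_3_cocycle (integer_mod_group n) (cyclic_cocycle n) \<and>
      canonical_dual (integer_mod_group n)
        \<notin> Units (Heisenberg_dual_sq (integer_mod_group n) (cyclic_cocycle n)) \<and>
      canonical (integer_mod_group n)
        \<notin> Units (Heisenberg_sq (integer_mod_group n) (cyclic_cocycle n)))"
proof -
  have main: "(canonical_dual G \<in> Units (Heisenberg_dual_sq G \<omega>) \<longrightarrow>
           (\<forall>a\<in>carrier G. \<omega> a (inv\<^bsub>G\<^esub> a) a = 1)) \<and>
        (canonical G \<in> Units (Heisenberg_sq G \<omega>) \<longrightarrow>
           (\<forall>a\<in>carrier G. \<omega> a (inv\<^bsub>G\<^esub> a) a = 1))"
    if "group G" "finite (carrier G)" "normalized_3_cocycle G \<omega>"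
    for G :: "('g, 'm) monoid_scheme" and \<omega> :: "'g \<Rightarrow> 'g \<Rightarrow> 'g \<Rightarrow> 'k"
    using group.canonical_dual_Units_imp[OF that] group.canonical_Units_imp[OF that] by blast
  have cyclic: "normalized_3_cocycle (integer_mod_group n) (cyclic_cocycle n) \<and>
      canonical_dual (integer_mod_group n)
        \<notin> Units (Heisenberg_dual_sq (integer_mod_group n) (cyclic_cocycle n)) \<and>
      canonical (integer_mod_group n)
        \<notin> Units (Heisenberg_sq (integer_mod_group n) (cyclic_cocycle n))" if n: "n \<ge> 2" for n
  proof -
    \<comment> \<open>The generator 1 is the witness against invertibility; it is a canonical
      representative because \<open>n \<ge> 2\<close>.\<close>
    have fin: "finite (carrier (integer_mod_group n))" and one: "1 \<in> carrier (integer_mod_group n)"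
      using n by (auto simp: carrier_integer_mod_group)
    have \<omega>: "normalized_3_cocycle (integer_mod_group n) (cyclic_cocycle n)"
      using n by (intro normalized_3_cocycle_cyclic) simp
    show ?thesis
      using group.canonical_dual_Units_imp[OF group_integer_mod_group fin \<omega> _ one]
        group.canonical_Units_imp[OF group_integer_mod_group fin \<omega> _ one]
        cyclic_cocycle_inv_neq_1[OF n] \<omega> by blast
  qed
  show ?thesis
    using main cyclic by blast
qed

end
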